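(* Let $N_R\ge 1$ and $\eta\ge 1$ be integers, let $\rho\in(0,1)$, and let $\gamma_1,\dots,\gamma_{N_R}$ be real numbers with $\gamma_j>\rho/(1-\rho)$ for every $j\in\{1,\dots,N_R\}$. Call a real vector $\mathbf{w}=(w_1,\dots,w_{N_R})$ feasible if $\sum_{j=1}^{N_R}w_j=1$ and $w_j\ge 0$ for all $j$. For feasible $\mathbf{w}$ define $$g(\mathbf{w})=\frac{\left(\sum_{j=1}^{N_R}w_j\left[(1-\rho)\gamma_j-\rho\right]\right)^2}{\sum_{j=1}^{N_R}w_j^2\left[(1-\rho)^2\gamma_j+\frac{1+\rho^2}{2}\right]},$$ and define $\mathbf{w}^o=(w_1^o,\dots,w_{N_R}^o)$ by $$w_j^o=c\,\frac{(1-\rho)\gamma_j-\rho}{(1-\rho)^2\gamma_j+\frac{1+\rho^2}{2}},\quad j=1,\dots,N_R,\qquad c=\left(\sum_{m=1}^{N_R}\frac{(1-\rho)\gamma_m-\rho}{(1-\rho)^2\gamma_m+\frac{1+\rho^2}{2}}\right)^{-1}.$$ If $\mathbf{w}$ is feasible and $\mathbf{w}\ne\mathbf{w}^o$, then $\mathbf{w}$ is non-optimal, i.e. there is a feasible $\mathbf{w}'$ with $g(\mathbf{w}')>g(\mathbf{w})$. Thus $\mathbf{w}^o$ is the unique maximizer of $g$ over feasible weight vectors, equivalently the unique feasible weight vector minimizing the missed-detection probability $$P_{MD}^M(\mathbf{w})=Q\left(\sqrt{\eta}\;\frac{\sum_{j=1}^{N_R}w_j\left[(1-\rho)\gamma_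j-\rho\right]}{\sqrt{\sum_{j=1}^{N_R}w_j^2\left[(1-\rho)^2\gamma_j+\frac{1+\rho^2}{2}\right]}}\right).$$
   Context: $Q(x)=\frac{1}{\sqrt{2\pi}}\int_x^\infty e^{-z^2/2}\,dz$ is the Gaussian Q-function. Setting: a receiver has $N_R$ antennas; $\eta$ is the length of a short training sequence, $\rho$ is the packet-detection threshold, and $\gamma_j$ is the signal-to-noise ratio of antenna $j$. When a packet is present, the (noise-normalized) compensated autocorrelation at antenna $j$ is modelled as a Gaussian random variable $r_{P,j}\sim N\left((1-\rho)\gamma_j-\rho,\ \frac{(1-\rho)^2}{\eta}\gamma_j+\frac{1+\rho^2}{2\eta}\right)$, independent across antennas. The receiver forms the weighted sum $r_P^M=\sum_{j=1}^{N_R}w_j r_{P,j}$, and a missed detection is the event that $r_P^M$ fails to exceed $0$; its probability under this model is the $P_{MD}^M(\mathbf{w})$ displayed in the claim. *)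

theory Defs
  imports "HOL-Probability.Probability"
begin

definition gaussian_Q :: "real \<Rightarrow> real" where
  "gaussian_Q x = 1 / sqrt (2 * pi) * (LBINT z:{x..}. exp (- (z\<^sup>2) / 2))"

text \<open>Mean of the normalized autocorrelation at an antenna with signal-to-noise ratio \<open>x\<close>, and
  its variance multiplied by the training length \<open>\<eta>\<close>.\<close>

definition ac_mean :: "real \<Rightarrow> real \<Rightarrow> real" where
  "ac_mean \<rho> x = (1 - \<rho>) * x - \<rho>"

definition ac_scaled_var :: "real \<Rightarrow> real \<Rightarrow> real" where
  "ac_scaled_var \<rho> x = (1 - \<rho>)\<^sup>2 * x + (1 + \<rho>\<^sup>2) / 2"

text \<open>The antennas are the elements of the finite index type \<open>'n\<close>, so their number is
  \<open>CARD('n)\<close>, which is at least 1.\<close>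

definition feasible :: "real ^ 'n \<Rightarrow> bool" where
  "feasible w \<longleftrightarrow> (\<Sum>j\<in>UNIV. w $ j) = 1 \<and> (\<forall>j. w $ j \<ge> 0)"

definition objective :: "real \<Rightarrow> real ^ 'n \<Rightarrow> real ^ 'n \<Rightarrow> real" where
  "objective \<rho> \<gamma> w =
     (\<Sum>j\<in>UNIV. w $ j * ac_mean \<rho> (\<gamma> $ j))\<^sup>2 /
     (\<Sum>j\<in>UNIV. (w $ j)\<^sup>2 * ac_scaled_var \<rho> (\<gamma> $ j))"

definition weight_normalizer :: "real \<Rightarrow> real ^ 'n \<Rightarrow> real" where
  "weight_normalizer \<rho> \<gamma> =
     inverse (\<Sum>m\<in>UNIV. ac_mean \<rho> (\<gamma> $ m) / ac_scaled_var \<rho> (\<gamma> $ m))"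

definition opt_weights :: "real \<Rightarrow> real ^ 'n \<Rightarrow> real ^ 'n" where
  "opt_weights \<rho> \<gamma> =
     (\<chi> j. weight_normalizer \<rho> \<gamma> * (ac_mean \<rho> (\<gamma> $ j) / ac_scaled_var \<rho> (\<gamma> $ j)))"

definition missed_detection_prob :: "nat \<Rightarrow> real \<Rightarrow> real ^ 'n \<Rightarrow> real ^ 'n \<Rightarrow> real" where
  "missed_detection_prob \<eta> \<rho> \<gamma> w =
     gaussian_Q (sqrt (real \<eta>) *
       ((\<Sum>j\<in>UNIV. w $ j * ac_mean \<rho> (\<gamma> $ j)) /
        sqrt (\<Sum>j\<in>UNIV. (w $ j)\<^sup>2 * ac_scaled_var \<rho> (\<gamma> $ j))))"

text \<open>The formula is the probability that the weighted sum of independent Gaussian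
  autocorrelations \<open>r\<close> fails to exceed 0.\<close>

lemma (in prob_space) prob_missed_detection:
  fixes \<eta> :: nat and \<rho> :: real and \<gamma> w :: "real ^ 'n" and r :: "'n \<Rightarrow> 'a \<Rightarrow> real"
  assumes "\<eta> \<ge> 1" "0 < \<rho>" "\<rho> < 1" "\<And>j. \<gamma> $ j > \<rho> / (1 - \<rho>)" "feasible w"
    and indep: "indep_vars (\<lambda>_. borel) r UNIV"
    and normal: "\<And>j. distributed M lborel (r j)
          (normal_density ((1 - \<rho>) * \<gamma> $ j - \<rho>)
             (sqrt ((1 - \<rho>)\<^sup>2 / \<eta> * \<gamma> $ j + (1 + \<rho>\<^sup>2) / (2 * \<eta>))))"
  shows "prob {x \<in> space M. (\<Sum>j\<in>UNIV. w $ j * r j x) \<le> 0} = missed_detection_prob \<eta> \<rho> \<gamma> w"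
proof -
  define S where "S = {j. w $ j \<noteq> 0}"
  define m where "m j = ac_mean \<rho> (\<gamma> $ j)" for j
  define v where "v j = ac_scaled_var \<rho> (\<gamma> $ j)" for j
  define X where "X x = (\<Sum>j\<in>UNIV. w $ j * r j x)" for x
  have eta: "real \<eta> > 0" using assms by simp
  have sdS: "S \<noteq> {}"
  proof
    assume "S = {}"
    then have "\<And>j. w $ j = 0" by (auto simp: S_def)
    then show False using assms(5) by (simp add: feasible_def)
  qed
  have vpos: "v j > 0" for j
  proof -
    have "\<rho> / (1 - \<rho>) > 0" using assms by simp
    then have "\<gamma> $ j > 0" using assms(4)[of j] by linarith
    moreover have "1 + \<rho>\<^sup>2 > 0" by (simp add: add_pos_nonneg)
    ultimately show ?thesis by (simp add: v_def ac_scaled_var_def add_nonneg_pos)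
  qed
  have var: "(1 - \<rho>)\<^sup>2 / \<eta> * \<gamma> $ j + (1 + \<rho>\<^sup>2) / (2 * \<eta>) = v j / \<eta>" for j
    using eta by (simp add: v_def ac_scaled_var_def field_simps)
  have supp: "(\<Sum>j\<in>UNIV. f j) = (\<Sum>j\<in>S. f j)" if "\<And>j. w $ j = 0 \<Longrightarrow> f j = 0" for f :: "'n \<Rightarrow> real"
    by (rule sum.mono_neutral_right) (auto simp: S_def that)
  define sd where "sd = sqrt ((\<Sum>j\<in>UNIV. (w $ j)\<^sup>2 * v j) / \<eta>)"
  define mu where "mu = (\<Sum>j\<in>UNIV. w $ j * m j)"
  have "distributed M lborel (\<lambda>x. \<Sum>j\<in>S. w $ j * r j x)
     (normal_density (\<Sum>j\<in>S. w $ j * m j) (sqrt (\<Sum>j\<in>S. (\<bar>w $ j\<bar> * sqrt (v j / \<eta>))\<^sup>2)))"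
  proof (rule sum_indep_normal)
    show "finite S" by simp
    show "S \<noteq> {}" by (rule sdS)
    show "indep_vars (\<lambda>_. borel) (\<lambda>j x. w $ j * r j x) S"
      by (rule indep_vars_compose2[OF indep_vars_subset[OF indep]]) auto
    show "0 < \<bar>w $ j\<bar> * sqrt (v j / \<eta>)" if "j \<in> S" for j
      using that vpos eta by (auto simp: S_def)
    show "distributed M lborel (\<lambda>x. w $ j * r j x)
        (normal_density (w $ j * m j) (\<bar>w $ j\<bar> * sqrt (v j / \<eta>)))" if "j \<in> S" for j
    proof -
      have "distributed M lborel (r j) (normal_density (m j) (sqrt (v j / \<eta>)))"
        using normal[of j] unfolding var by (simp add: m_def ac_mean_def)
      from normal_density_affine[OF this, of "w $ j" 0] show ?thesis
        using that vpos eta by (auto simp: S_def)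
    qed
  qed
  moreover have "(\<Sum>j\<in>S. (\<bar>w $ j\<bar> * sqrt (v j / \<eta>))\<^sup>2) = (\<Sum>j\<in>UNIV. (w $ j)\<^sup>2 * v j) / \<eta>"
    using vpos eta
    by (subst supp) (auto simp: power_mult_distrib sum_divide_distrib less_imp_le)
  ultimately have X: "distributed M lborel X (normal_density mu sd)"
    by (simp add: X_def[abs_def] supp mu_def sd_def)
  have "(\<Sum>j\<in>S. (w $ j)\<^sup>2 * v j) > 0"
    by (rule sum_pos) (use sdS vpos in \<open>auto simp: S_def\<close>)
  then have sd: "sd > 0" using eta by (simp add: sd_def supp)
  have "distributed M lborel (\<lambda>x. mu / sd + (- 1 / sd) * X x)
      (normal_density (mu / sd + (- 1 / sd) * mu) (\<bar>- 1 / sd\<bar> * sd))"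
    by (rule normal_density_affine[OF X sd]) (use sd in simp)
  then have Z: "distributed M lborel (\<lambda>x. mu / sd - X x / sd) std_normal_density"
    using sd by simp
  have eq: "{x \<in> space M. X x \<le> 0} = (\<lambda>x. mu / sd - X x / sd) -` {mu / sd..} \<inter> space M"
    using sd by (auto simp: field_simps)
  have int: "set_integrable lborel {mu / sd..} std_normal_density"
    unfolding set_integrable_def by (rule integrable_mult_indicator) auto
  have "emeasure M {x \<in> space M. X x \<le> 0}
      = (\<integral>\<^sup>+z. ennreal (indicator {mu / sd..} z *\<^sub>R std_normal_density z) \<partial>lborel)"
    unfolding eq by (subst distributed_emeasure[OF Z])
      (auto intro!: nn_integral_cong split: split_indicator)
  also have "\<dots> = ennreal (LBINT z:{mu / sd..}. std_normal_density z)"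
    unfolding set_lebesgue_integral_def
    by (rule nn_integral_eq_integral) (use int in \<open>auto simp: set_integrable_def\<close>)
  finally have "prob {x \<in> space M. X x \<le> 0} = (LBINT z:{mu / sd..}. std_normal_density z)"
    by (simp add: measure_def set_lebesgue_integral_def integral_nonneg_AE)
  also have "\<dots> = gaussian_Q (mu / sd)"
    by (simp add: gaussian_Q_def std_normal_density_def)
  also have "mu / sd = sqrt \<eta> * (mu / sqrt (\<Sum>j\<in>UNIV. (w $ j)\<^sup>2 * v j))"
    by (simp add: sd_def real_sqrt_divide)
  finally show ?thesis
    by (simp add: X_def missed_detection_prob_def mu_def m_def v_def)
qed

end

(* Idea: with means m j > 0 and scaled variances v j > 0, completing the square in the v-weighted
   inner product gives, for K = sum m j ^ 2 / v j, A = sum w j m j and B = sum w j ^ 2 v j,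
     B - A ^ 2 / K = sum v j (w j - (A / K) m j / v j) ^ 2.
   Hence A ^ 2 / B <= K, with equality only for w proportional to m / v, and the constraint
   sum w j = 1 fixes the factor. Since A > 0 on feasible vectors, the argument of Q is
   sqrt (eta * A ^ 2 / B), and Q is strictly decreasing. *)
theory Submission
  imports Defs
begin

text \<open>Pythagoras for the inner product weighted by \<open>v\<close>: there \<open>a\<close>
  and \<open>b / v\<close> have inner product \<open>A\<close>, and \<open>b / v\<close> has squared
  norm \<open>K\<close>, so \<open>A / K\<close> is the coefficient of the orthogonal projection of
  \<open>a\<close> onto \<open>b / v\<close>.\<close>

lemma sum_sq_residual:
  fixes I :: "'i set" and a b v :: "'i \<Rightarrow> real"
  defines "K \<equiv> \<Sum>j\<in>I. (b j)\<^sup>2 / v j" and "A \<equiv> \<Sum>j\<in>I. a j * b j"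
  assumes v: "\<And>j. j \<in> I \<Longrightarrow> v j > 0" and "K \<noteq> 0"
  shows "(\<Sum>j\<in>I. v j * (a j - A / K * (b j / v j))\<^sup>2) = (\<Sum>j\<in>I. (a j)\<^sup>2 * v j) - A\<^sup>2 / K"
proof -
  have "v j * (a j - A / K * (b j / v j))\<^sup>2
      = (a j)\<^sup>2 * v j - 2 * (A / K) * (a j * b j) + (A / K)\<^sup>2 * ((b j)\<^sup>2 / v j)" if "j \<in> I" for j
    using v[OF that] \<open>K \<noteq> 0\<close> by (simp add: field_simps power2_eq_square)
  then have "(\<Sum>j\<in>I. v j * (a j - A / K * (b j / v j))\<^sup>2)
      = (\<Sum>j\<in>I. (a j)\<^sup>2 * v j) - 2 * (A / K) * A + (A / K)\<^sup>2 * K"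
    by (simp add: sum.distrib sum_subtractf sum_distrib_left K_def A_def)
  also have "\<dots> = (\<Sum>j\<in>I. (a j)\<^sup>2 * v j) - A\<^sup>2 / K"
    using \<open>K \<noteq> 0\<close> by (simp add: field_simps power2_eq_square)
  finally show ?thesis .
qed

lemma integrable_exp_neg_half_square: "integrable lborel (\<lambda>z::real. exp (- (z\<^sup>2) / 2))"
proof -
  have "(\<lambda>z::real. exp (- (z\<^sup>2) / 2)) = (\<lambda>z. sqrt (2 * pi) * std_normal_density z)"
    by (simp add: std_normal_density_def fun_eq_iff)
  then show ?thesis by (simp only:) (intro integrable_mult_right, simp)
qed

text \<open>The two tails differ by the integral over \<open>{x..<y}\<close>, which is at least the
  interval length times a positive lower bound \<open>c\<close> of the integrand.\<close>

lemma gaussian_Q_strict_antimono: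
  assumes "x < y"
  shows "gaussian_Q y < gaussian_Q x"
proof -
  have int: "integrable lborel (\<lambda>z. indicator {t..} z *\<^sub>R exp (- (z\<^sup>2) / 2))" for t :: real
    by (rule integrable_mult_indicator[OF _ integrable_exp_neg_half_square]) simp
  \<comment> \<open>Adding the two squares bounds the square of every point between \<open>x\<close>
    and \<open>y\<close>, whatever the signs of the endpoints.\<close>
  define c where "c = exp (- (x\<^sup>2 + y\<^sup>2) / 2)"
  have c: "c \<le> exp (- (z\<^sup>2) / 2)" if "x \<le> z" "z < y" for z
  proof -
    have "\<bar>z\<bar> \<le> \<bar>x\<bar> \<or> \<bar>z\<bar> \<le> \<bar>y\<bar>" using that by linarith
    then have "z\<^sup>2 \<le> x\<^sup>2 + y\<^sup>2"
      by (auto simp flip: abs_le_square_iff intro: add_increasing add_increasing2)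
    then show ?thesis by (simp add: c_def)
  qed
  have intc: "integrable lborel (\<lambda>z. c * indicator {x..<y} z)"
    by (intro integrable_mult_right) (use assms in simp)
  have "0 < c * (y - x)" using assms by (simp add: c_def)
  then have "(LBINT z:{y..}. exp (- (z\<^sup>2) / 2))
      < c * (y - x) + (LBINT z:{y..}. exp (- (z\<^sup>2) / 2))"
    by simp
  also have "c * (y - x) + (LBINT z:{y..}. exp (- (z\<^sup>2) / 2))
      = (\<integral>z. c * indicator {x..<y} z + indicator {y..} z *\<^sub>R exp (- (z\<^sup>2) / 2) \<partial>lborel)"
    unfolding set_lebesgue_integral_def
    by (subst Bochner_Integration.integral_add[OF intc int]) (use assms in simp)
  \<comment> \<open>Pointwise comparison: the constant \<open>c\<close> lies below the integrand on
    \<open>{x..<y}\<close>, and the two sides agree elsewhere.\<close>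
  also have "\<dots> \<le> (LBINT z:{x..}. exp (- (z\<^sup>2) / 2))"
    unfolding set_lebesgue_integral_def
    by (rule integral_mono[OF Bochner_Integration.integrable_add[OF intc int] int])
      (use assms c in \<open>auto split: split_indicator\<close>)
  finally have "(LBINT z:{y..}. exp (- (z\<^sup>2) / 2)) < (LBINT z:{x..}. exp (- (z\<^sup>2) / 2))" .
  then show ?thesis
    by (simp add: gaussian_Q_def divide_strict_right_mono)
qed

text \<open>The zero vector has entry sum 0, not 1. One positive entry makes the sums of nonnegative
  terms in mean and variance strictly positive.\<close>

lemma feasible_has_pos:
  assumes "feasible w"
  obtains j where "w $ j > 0"
proof -
  have "\<exists>j. w $ j \<noteq> 0"
  proof (rule ccontr)
    assume "\<nexists>j. w $ j \<noteq> 0"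
    then show False using assms by (simp add: feasible_def)
  qed
  then show thesis using assms that by (metis feasible_def order_less_le)
qed

context
  fixes \<rho> :: real and \<gamma> :: "real ^ 'n"
  assumes \<rho>: "0 < \<rho>" "\<rho> < 1" and \<gamma>: "\<And>j. \<gamma> $ j > \<rho> / (1 - \<rho>)"
begin

text \<open>This is the bound on \<open>\<gamma>\<close> multiplied by
  \<open>1 - \<rho> > 0\<close>.\<close>

lemma ac_mean_pos: "ac_mean \<rho> (\<gamma> $ j) > 0"
  using \<gamma>[of j] \<rho> by (simp add: ac_mean_def field_simps)

lemma ac_scaled_var_pos: "ac_scaled_var \<rho> (\<gamma> $ j) > 0"
proof -
  have "\<rho> / (1 - \<rho>) > 0" using \<rho> by simp
  then have "\<gamma> $ j > 0" using \<gamma>[of j] by linarith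
  then show ?thesis by (simp add: ac_scaled_var_def add_nonneg_pos add_pos_nonneg)
qed

lemma weight_normalizer_pos: "weight_normalizer \<rho> \<gamma> > 0"
  unfolding weight_normalizer_def
  by (intro positive_imp_inverse_positive sum_pos divide_pos_pos ac_mean_pos ac_scaled_var_pos) auto

lemma feasible_opt_weights: "feasible (opt_weights \<rho> \<gamma>)"
proof -
  have "(\<Sum>j\<in>UNIV. opt_weights \<rho> \<gamma> $ j) = 1"
    using weight_normalizer_pos unfolding opt_weights_def vec_lambda_beta sum_distrib_left[symmetric]
    by (simp add: weight_normalizer_def)
  then show ?thesis
    using weight_normalizer_pos ac_mean_pos ac_scaled_var_pos
    by (simp add: feasible_def opt_weights_def less_imp_le)
qed

lemma feasible_mean_pos:
  assumes "feasible w"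
  shows "(\<Sum>j\<in>UNIV. w $ j * ac_mean \<rho> (\<gamma> $ j)) > 0"
proof -
  obtain i where "w $ i > 0" using assms by (rule feasible_has_pos)
  then show ?thesis
    using assms ac_mean_pos by (intro sum_pos2[of _ i]) (auto simp: feasible_def less_imp_le)
qed

lemma feasible_var_pos:
  assumes "feasible w"
  shows "(\<Sum>j\<in>UNIV. (w $ j)\<^sup>2 * ac_scaled_var \<rho> (\<gamma> $ j)) > 0"
proof -
  obtain i where "w $ i > 0" using assms by (rule feasible_has_pos)
  then show ?thesis
    using ac_scaled_var_pos by (intro sum_pos2[of _ i]) (auto simp: less_imp_le)
qed

text \<open>The objective is invariant under scaling, so the normalizer cancels: with
  \<open>c\<close> the normalizer, the quotient is \<open>(c * K)^2 / (c^2 * K)\<close>. The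
  Cauchy-Schwarz bound is thus attained.\<close>

lemma objective_opt_weights:
  "objective \<rho> \<gamma> (opt_weights \<rho> \<gamma>) = (\<Sum>j\<in>UNIV. (ac_mean \<rho> (\<gamma> $ j))\<^sup>2 / ac_scaled_var \<rho> (\<gamma> $ j))"
    (is "_ = ?K")
proof -
  define c where "c = weight_normalizer \<rho> \<gamma>"
  have vne: "ac_scaled_var \<rho> (\<gamma> $ j) \<noteq> 0" for j
    using ac_scaled_var_pos[of j] by simp
  have "(\<Sum>j\<in>UNIV. opt_weights \<rho> \<gamma> $ j * ac_mean \<rho> (\<gamma> $ j)) = c * ?K"
    by (simp add: opt_weights_def c_def sum_distrib_left power2_eq_square mult.assoc)
  moreover have "(\<Sum>j\<in>UNIV. (opt_weights \<rho> \<gamma> $ j)\<^sup>2 * ac_scaled_var \<rho> (\<gamma> $ j)) = c\<^sup>2 * ?K"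
    using vne by (simp add: opt_weights_def c_def sum_distrib_left power2_eq_square ac_simps)
  ultimately show ?thesis
    using weight_normalizer_pos
    by (simp add: objective_def c_def power_mult_distrib) (simp add: power2_eq_square)
qed

lemma objective_less_opt:
  assumes w: "feasible w" and ne: "w \<noteq> opt_weights \<rho> \<gamma>"
  shows "objective \<rho> \<gamma> w < objective \<rho> \<gamma> (opt_weights \<rho> \<gamma>)"
proof -
  define m where "m j = ac_mean \<rho> (\<gamma> $ j)" for j
  define v where "v j = ac_scaled_var \<rho> (\<gamma> $ j)" for j
  define K where "K = (\<Sum>j\<in>UNIV. (m j)\<^sup>2 / v j)"
  define A where "A = (\<Sum>j\<in>UNIV. w $ j * m j)"
  define B where "B = (\<Sum>j\<in>UNIV. (w $ j)\<^sup>2 * v j)"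
  have v: "v j > 0" and m: "m j > 0" for j
    using ac_scaled_var_pos ac_mean_pos by (auto simp: v_def m_def)
  have K: "K > 0" unfolding K_def using v m by (intro sum_pos divide_pos_pos zero_less_power) auto
  have B: "B > 0" using feasible_var_pos[OF w] by (simp add: B_def v_def)
  \<comment> \<open>Some residual is nonzero: otherwise summing all entries gives
    \<open>A / K\<close> times the sum of \<open>m j / v j\<close> equal to 1, which forces
    \<open>A / K\<close> to be the normalizer and \<open>w\<close> to be the optimal vector.\<close>
  have "\<exists>i. w $ i \<noteq> A / K * (m i / v i)"
  proof (rule ccontr)
    assume "\<nexists>i. w $ i \<noteq> A / K * (m i / v i)"
    then have w_eq: "w $ j = A / K * (m j / v j)" for j by blast
    then have "A / K * (\<Sum>j\<in>UNIV. m j / v j) = (\<Sum>j\<in>UNIV. w $ j)"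
      by (simp only: sum_distrib_left)
    also have "\<dots> = 1" using w by (simp add: feasible_def)
    finally have "A / K = weight_normalizer \<rho> \<gamma>"
      unfolding weight_normalizer_def m_def v_def
      by (metis inverse_inverse_eq inverse_unique)
    then have "w = opt_weights \<rho> \<gamma>"
      by (simp only: vec_eq_iff opt_weights_def vec_lambda_beta w_eq m_def v_def) simp
    with ne show False ..
  qed
  then obtain i where "w $ i \<noteq> A / K * (m i / v i)" ..
  then have "0 < (\<Sum>j\<in>UNIV. v j * (w $ j - A / K * (m j / v j))\<^sup>2)"
    using v by (intro sum_pos2[of _ i]) (auto simp: less_imp_le)
  also have "\<dots> = B - A\<^sup>2 / K"
    unfolding A_def B_def K_def
    by (rule sum_sq_residual) (use v K in \<open>auto simp: K_def\<close>)
  finally have "A\<^sup>2 / B < K"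
    using K B by (simp add: field_simps)
  then show ?thesis
    unfolding objective_opt_weights by (simp add: objective_def A_def B_def K_def m_def v_def)
qed

text \<open>Positivity of the weighted mean makes it the square root of its own square, so the
  argument of Q depends on \<open>w\<close> only through the objective, and increasingly.\<close>

lemma missed_detection_prob_eq_objective:
  assumes "feasible w"
  shows "missed_detection_prob \<eta> \<rho> \<gamma> w = gaussian_Q (sqrt (\<eta> * objective \<rho> \<gamma> w))"
  using feasible_mean_pos[OF assms]
  by (simp add: missed_detection_prob_def objective_def real_sqrt_mult real_sqrt_divide)

end

theorem proposition2:
  fixes \<eta> :: nat and \<rho> :: real and \<gamma> :: "real ^ 'n"
  assumes "\<eta> \<ge> 1"
    and "0 < \<rho>" and "\<rho> < 1"
    and "\<And>j. \<gamma> $ j > \<rho> / (1 - \<rho>)"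
  shows "(\<forall>w. feasible w \<and> w \<noteq> opt_weights \<rho> \<gamma> \<longrightarrow>
            (\<exists>w'. feasible w' \<and> objective \<rho> \<gamma> w' > objective \<rho> \<gamma> w)) \<and>
         (\<forall>w. is_arg_max (objective \<rho> \<gamma>) feasible w \<longleftrightarrow> w = opt_weights \<rho> \<gamma>) \<and>
         (\<forall>w. is_arg_min (missed_detection_prob \<eta> \<rho> \<gamma>) feasible w \<longleftrightarrow> w = opt_weights \<rho> \<gamma>)"
proof -
  let ?o = "opt_weights \<rho> \<gamma>"
  note feas = feasible_opt_weights[OF assms(2-4)]
  note less = objective_less_opt[OF assms(2-4)]
  \<comment> \<open>Scaling by \<open>\<eta> \<ge> 1\<close> and taking roots keep the strict
    inequality between objectives; Q reverses it.\<close>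
  have less_md: "missed_detection_prob \<eta> \<rho> \<gamma> ?o < missed_detection_prob \<eta> \<rho> \<gamma> w"
    if "feasible w" "w \<noteq> ?o" for w
    using less[OF that] \<open>\<eta> \<ge> 1\<close>
    by (simp add: missed_detection_prob_eq_objective[OF assms(2-4)] feas that(1)
        gaussian_Q_strict_antimono)
  \<comment> \<open>Every other feasible vector is beaten by \<open>?o\<close>, and by asymmetry of
    the order none beats \<open>?o\<close>.\<close>
  have "is_arg_max (objective \<rho> \<gamma>) feasible w \<longleftrightarrow> w = ?o" for w
    unfolding is_arg_max_def using feas less by (metis order_less_asym order_less_irrefl)
  moreover have "is_arg_min (missed_detection_prob \<eta> \<rho> \<gamma>) feasible w \<longleftrightarrow> w = ?o" for w
    unfolding is_arg_min_def using feas less_md by (metis order_less_asym order_less_irrefl)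
  ultimately show ?thesis using feas less by blast
qed

end
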